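(* Let $f:\mathbb{R}^n\to\mathbb{R}\cup\{\infty\}$ be a proper, lower semicontinuous, convex function with $\mathrm{dom}\,f$ unbounded, and let $C\subset\mathbb{R}^n$ be a nonempty closed convex set such that $C\cap\mathrm{dom}\,f$ is unbounded. Assume $$\partial^\infty f(\infty)\cap\bigl(-N(\infty;C)\bigr)=\{0\}.$$ Then $$\partial(f+\delta_C)(\infty)\subset\partial f(\infty)+N(\infty;C).$$ In particular, if $0\in\partial(f+\delta_C)(\infty)$, then there exist $u\in\partial f(\infty)$ and $v\in N(\infty;C)$ with $u+v=0$.
   Context: $\delta_C(x)=0$ if $x\in C$ and $\infty$ otherwise. For $\varphi:\mathbb{R}^n\to\mathbb{R}\cup\{\infty\}$: $\mathrm{dom}\,\varphi=\{x\mid\varphi(x)<\infty\}$; $\varphi$ is proper if $\mathrm{dom}\,\varphi\ne\emptyset$; $\mathrm{epi}\,\varphi=\{(x,r)\in\mathbb{R}^n\times\mathbb{R}\mid r\ge\varphi(x)\}$. $T(\infty;C)$ is the set of $w\in\mathbb{R}^n$ such that for all sequences $x_k\in C$ with $\|x_k\|\to\infty$ and all $t_k>0$ with $t_k\to0$ there exist $w_k\to w$ with $x_k+t_kw_k\in C$ for all $k$; $N(\infty;C)=\{v\mid\langle v,w\rangle\le0\ \forall w\in T(\infty;C)\}$. For $\varphi$ proper, lower semicontinuous, convex with $\mathrm{dom}\,\varphi$ unbounded, and $I=\{1,\dots,n\}$ selecting the $x$-coordinates in $\mathbb{R}^n\times\mathbb{R}$: $T(\infty_I;\mathrm{epi}\,\varphi)$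 is the set of $(w,\rho)$ such that for all sequences $(x_k,r_k)\in\mathrm{epi}\,\varphi$ with $\|x_k\|\to\infty$ and all $t_k>0$ with $t_k\to0$ there exist $(w_k,\rho_k)\to(w,\rho)$ with $(x_k,r_k)+t_k(w_k,\rho_k)\in\mathrm{epi}\,\varphi$ for all $k$. $N(\infty_I;\mathrm{epi}\,\varphi)=\{(u,c)\mid\langle u,w\rangle+c\rho\le0\ \forall(w,\rho)\in T(\infty_I;\mathrm{epi}\,\varphi)\}$. $\partial\varphi(\infty)=\{u\mid(u,-1)\in N(\infty_I;\mathrm{epi}\,\varphi)\}$ and $\partial^\infty\varphi(\infty)=\{u\mid(u,0)\in N(\infty_I;\mathrm{epi}\,\varphi)\}$. *)

theory Defs
  imports "HOL-Analysis.Analysis"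
begin

text \<open>
  Functions into \<open>\<real> \<union> {\<infinity>}\<close> are \<^typ>\<open>ereal\<close>-valued; that they never take the value \<open>- \<infinity>\<close> is
  part of \<open>proper_fun\<close>.
\<close>

definition eff_dom :: "('a \<Rightarrow> ereal) \<Rightarrow> 'a set" where
  "eff_dom \<phi> = {x. \<phi> x < \<infinity>}"

definition proper_fun :: "('a \<Rightarrow> ereal) \<Rightarrow> bool" where
  "proper_fun \<phi> \<longleftrightarrow> (\<forall>x. \<phi> x \<noteq> - \<infinity>) \<and> eff_dom \<phi> \<noteq> {}"

definition lsc_fun :: "('a::topological_space \<Rightarrow> ereal) \<Rightarrow> bool" where
  "lsc_fun \<phi> \<longleftrightarrow> (\<forall>x. \<phi> x \<le> Liminf (at x) \<phi>)"

definition convex_fun :: "('a::real_vector \<Rightarrow> ereal) \<Rightarrow> bool" where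
  "convex_fun \<phi> \<longleftrightarrow>
     (\<forall>x y (t::real). 0 < t \<and> t < 1 \<longrightarrow>
        \<phi> ((1 - t) *\<^sub>R x + t *\<^sub>R y) \<le> ereal (1 - t) * \<phi> x + ereal t * \<phi> y)"

definition epi :: "('a \<Rightarrow> ereal) \<Rightarrow> ('a \<times> real) set" where
  "epi \<phi> = {(x, r). \<phi> x \<le> ereal r}"

definition indicator_fun :: "'a set \<Rightarrow> 'a \<Rightarrow> ereal" where
  "indicator_fun C x = (if x \<in> C then 0 else \<infinity>)"

definition tangent_inf :: "'a::real_normed_vector set \<Rightarrow> 'a set" where
  "tangent_inf C =
     {w. \<forall>(x :: nat \<Rightarrow> 'a) (t :: nat \<Rightarrow> real).
           (\<forall>k. x k \<in> C) \<and> filterlim (\<lambda>k. norm (x k)) at_top sequentially \<and>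
           (\<forall>k. t k > 0) \<and> t \<longlonglongrightarrow> 0 \<longrightarrow>
           (\<exists>w'. w' \<longlonglongrightarrow> w \<and> (\<forall>k. x k + t k *\<^sub>R w' k \<in> C))}"

definition normal_inf :: "'a::real_inner set \<Rightarrow> 'a set" where
  "normal_inf C = {v. \<forall>w\<in>tangent_inf C. inner v w \<le> 0}"

text \<open>
  Variants for subsets of \<open>\<real>\<^sup>n \<times> \<real>\<close> in which only the first component is sent to infinity (the
  index set \<open>I = {1,\<dots>,n}\<close>); the real component of the sequence is unrestricted.
\<close>

definition tangent_inf_fst :: "('a::real_normed_vector \<times> real) set \<Rightarrow> ('a \<times> real) set" where
  "tangent_inf_fst E =
     {(w, \<rho>). \<forall>(x :: nat \<Rightarrow> 'a) (r :: nat \<Rightarrow> real) (t :: nat \<Rightarrow> real).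
           (\<forall>k. (x k, r k) \<in> E) \<and> filterlim (\<lambda>k. norm (x k)) at_top sequentially \<and>
           (\<forall>k. t k > 0) \<and> t \<longlonglongrightarrow> 0 \<longrightarrow>
           (\<exists>w' \<rho>'. (\<lambda>k. (w' k, \<rho>' k)) \<longlonglongrightarrow> (w, \<rho>) \<and>
                     (\<forall>k. (x k, r k) + t k *\<^sub>R (w' k, \<rho>' k) \<in> E))}"

definition normal_inf_fst :: "('a::real_inner \<times> real) set \<Rightarrow> ('a \<times> real) set" where
  "normal_inf_fst E = {(u, c). \<forall>(w, \<rho>)\<in>tangent_inf_fst E. inner u w + c * \<rho> \<le> 0}"

definition subdiff_inf :: "('a::real_inner \<Rightarrow> ereal) \<Rightarrow> 'a set" where
  "subdiff_inf \<phi> = {u. (u, -1) \<in> normal_inf_fst (epi \<phi>)}"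

definition singular_subdiff_inf :: "('a::real_inner \<Rightarrow> ereal) \<Rightarrow> 'a set" where
  "singular_subdiff_inf \<phi> = {u. (u, 0) \<in> normal_inf_fst (epi \<phi>)}"

end

theory Submission
  imports Defs
begin

text \<open>
  The epigraph of \<open>f + \<delta>\<^sub>C\<close> is the intersection of \<open>epi f\<close> with \<open>C \<times> \<real>\<close>. Let \<open>P\<close> and \<open>Q\<close> be the
  tangent cones at infinity of these two convex sets; both are convex cones. A hyperplane having
  \<open>P - Q\<close> on one side would give a nonzero element of \<open>\<partial>\<^sup>\<infinity>f(\<infinity>) \<inter> (- N(\<infinity>; C))\<close>, so the
  qualification condition forces \<open>P - Q\<close> to be the whole space. This has two consequences. First,
  every direction in \<open>P \<inter> Q\<close> is tangent to the intersection: the feasible steps into the two sets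
  disagree by \<open>o(t)\<close>, and the discrepancy is removed by adding a small multiple of further feasible
  steps, which convexity of the sets permits. Second, a linear functional that is nonpositive on
  \<open>P \<inter> Q\<close> is a sum of functionals nonpositive on \<open>P\<close> and on \<open>Q\<close>. The latter is of the form
  \<open>(v, 0)\<close> with \<open>v \<in> N(\<infinity>; C)\<close>.
\<close>

section \<open>Tangent cones at infinity relative to a map\<close>

text \<open>Common form of the two tangent cones: \<open>g\<close> selects the part of a point that
  is sent to infinity. The identity gives \<open>tangent_inf\<close> and \<open>fst\<close> gives
  \<open>tangent_inf_fst\<close>, so the cone and intersection arguments are carried out
  once.\<close>

definition tangent_along :: "('a::real_normed_vector \<Rightarrow> 'b::real_normed_vector) \<Rightarrow> 'a set \<Rightarrow> 'a set" where
  "tangent_along g E =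
     {w. \<forall>(x :: nat \<Rightarrow> 'a) (t :: nat \<Rightarrow> real).
           (\<forall>k. x k \<in> E) \<and> filterlim (\<lambda>k. norm (g (x k))) at_top sequentially \<and>
           (\<forall>k. t k > 0) \<and> t \<longlonglongrightarrow> 0 \<longrightarrow>
           (\<exists>w'. w' \<longlonglongrightarrow> w \<and> (\<forall>k. x k + t k *\<^sub>R w' k \<in> E))}"

lemma tangent_alongD:
  assumes "w \<in> tangent_along g E" "\<And>k. x k \<in> E"
    "filterlim (\<lambda>k. norm (g (x k))) at_top sequentially" "\<And>k. t k > 0" "t \<longlonglongrightarrow> 0"
  shows "\<exists>w'. w' \<longlonglongrightarrow> w \<and> (\<forall>k. x k + t k *\<^sub>R w' k \<in> E)"
  using assms unfolding tangent_along_def by blast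

lemma tangent_inf_fst_eq: "tangent_inf_fst E = tangent_along fst E"
proof -
  have *: "(\<forall>(x :: nat \<Rightarrow> 'a) (r :: nat \<Rightarrow> real) (t :: nat \<Rightarrow> real).
           (\<forall>k. (x k, r k) \<in> E) \<and> filterlim (\<lambda>k. norm (x k)) at_top sequentially \<and>
           (\<forall>k. t k > 0) \<and> t \<longlonglongrightarrow> 0 \<longrightarrow>
           (\<exists>w' \<rho>'. (\<lambda>k. (w' k, \<rho>' k)) \<longlonglongrightarrow> (w, \<rho>) \<and>
                     (\<forall>k. (x k, r k) + t k *\<^sub>R (w' k, \<rho>' k) \<in> E))) \<longleftrightarrow>
        (w, \<rho>) \<in> tangent_along fst E" (is "?L \<longleftrightarrow> _") for w \<rho>
  proof
    assume L: ?L
    have "\<exists>w'. w' \<longlonglongrightarrow> (w, \<rho>) \<and> (\<forall>k. z k + t k *\<^sub>R w' k \<in> E)"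
      if "\<forall>k. z k \<in> E" "filterlim (\<lambda>k. norm (fst (z k))) at_top sequentially"
        "\<forall>k. t k > 0" "t \<longlonglongrightarrow> 0" for z and t :: "nat \<Rightarrow> real"
    proof -
      have "\<exists>w' \<rho>'. (\<lambda>k. (w' k, \<rho>' k)) \<longlonglongrightarrow> (w, \<rho>) \<and>
          (\<forall>k. (fst (z k), snd (z k)) + t k *\<^sub>R (w' k, \<rho>' k) \<in> E)"
        by (rule L[rule_format]) (simp add: that)
      then obtain w' \<rho>' where "(\<lambda>k. (w' k, \<rho>' k)) \<longlonglongrightarrow> (w, \<rho>)"
          "\<forall>k. (fst (z k), snd (z k)) + t k *\<^sub>R (w' k, \<rho>' k) \<in> E"
        by blast
      then show ?thesis by (intro exI[of _ "\<lambda>k. (w' k, \<rho>' k)"]) simp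
    qed
    then show "(w, \<rho>) \<in> tangent_along fst E" by (auto simp: tangent_along_def)
  next
    assume R: "(w, \<rho>) \<in> tangent_along fst E"
    show ?L
    proof (intro allI impI, elim conjE)
      fix x :: "nat \<Rightarrow> 'a" and r t :: "nat \<Rightarrow> real"
      assume "\<forall>k. (x k, r k) \<in> E" "filterlim (\<lambda>k. norm (x k)) at_top sequentially"
        "\<forall>k. t k > 0" "t \<longlonglongrightarrow> 0"
      then obtain z where "z \<longlonglongrightarrow> (w, \<rho>)" "\<And>k. (x k, r k) + t k *\<^sub>R z k \<in> E"
        using tangent_alongD[OF R, of "\<lambda>k. (x k, r k)" t] by auto
      then show "\<exists>w' \<rho>'. (\<lambda>k. (w' k, \<rho>' k)) \<longlonglongrightarrow> (w, \<rho>) \<and>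
                     (\<forall>k. (x k, r k) + t k *\<^sub>R (w' k, \<rho>' k) \<in> E)"
        by (intro exI[of _ "\<lambda>k. fst (z k)"] exI[of _ "\<lambda>k. snd (z k)"]) simp
    qed
  qed
  show ?thesis unfolding tangent_inf_fst_def using * by auto
qed

lemma tangent_inf_eq: "tangent_inf C = tangent_along (\<lambda>x. x) C"
  by (simp add: tangent_inf_def tangent_along_def)

text \<open>The real coordinate is unconstrained, so a constant second component completes any
  feasible step into \<open>C\<close>. Since polarity reverses inclusions, this direction is the one
  that makes normals to the product yield normals to \<open>C\<close>.\<close>

lemma tangent_inf_Times_UNIV:
  "tangent_inf C \<times> UNIV \<subseteq> tangent_along fst (C \<times> (UNIV :: 'b::real_normed_vector set))"
proof clarify
  fix w :: 'a and \<rho> :: 'b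
  assume w: "w \<in> tangent_inf C"
  have "\<exists>w'. w' \<longlonglongrightarrow> (w, \<rho>) \<and> (\<forall>k. z k + t k *\<^sub>R w' k \<in> C \<times> UNIV)"
    if "\<forall>k. z k \<in> C \<times> UNIV" "filterlim (\<lambda>k. norm (fst (z k))) at_top sequentially"
      "\<forall>k. t k > 0" "t \<longlonglongrightarrow> 0" for z :: "nat \<Rightarrow> 'a \<times> 'b" and t :: "nat \<Rightarrow> real"
  proof -
    have "\<exists>w'. w' \<longlonglongrightarrow> w \<and> (\<forall>k. fst (z k) + t k *\<^sub>R w' k \<in> C)"
      by (rule tangent_alongD[OF w[unfolded tangent_inf_eq]])
        (use that in \<open>auto simp: mem_Times_iff\<close>)
    then obtain w' where w': "w' \<longlonglongrightarrow> w" "\<And>k. fst (z k) + t k *\<^sub>R w' k \<in> C" by blast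
    have "(\<lambda>k. (w' k, \<rho>)) \<longlonglongrightarrow> (w, \<rho>)" by (intro tendsto_intros w')
    then show ?thesis
      using w'(2) by (intro exI[of _ "\<lambda>k. (w' k, \<rho>)"]) (simp add: mem_Times_iff)
  qed
  then show "(w, \<rho>) \<in> tangent_along fst (C \<times> UNIV)" by (auto simp: tangent_along_def)
qed

text \<open>For sums, the points reached by the first steps form a sequence in \<open>E\<close> that
  still goes to infinity under \<open>g\<close>, so the second steps can start from there. For
  positive multiples, the factor is absorbed into the step length.\<close>

lemma convex_cone_tangent_along:
  assumes g: "bounded_linear g"
  shows "convex_cone (tangent_along g E)"
  unfolding convex_cone_iff
proof (intro conjI ballI allI impI)
  show "0 \<in> tangent_along g E"
    unfolding tangent_along_def by (auto intro!: exI[of _ "\<lambda>_. 0"])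
next
  fix u v assume u: "u \<in> tangent_along g E" and v: "v \<in> tangent_along g E"
  have "\<exists>w'. w' \<longlonglongrightarrow> u + v \<and> (\<forall>k. x k + t k *\<^sub>R w' k \<in> E)"
    if x: "\<And>k. x k \<in> E" and lim: "filterlim (\<lambda>k. norm (g (x k))) at_top sequentially"
      and t: "\<And>k. t k > 0" "t \<longlonglongrightarrow> 0" for x and t :: "nat \<Rightarrow> real"
  proof -
    obtain u' where u': "u' \<longlonglongrightarrow> u" "\<And>k. x k + t k *\<^sub>R u' k \<in> E"
      using tangent_alongD[OF u x lim t] by blast
    have "(\<lambda>k. norm (g (t k *\<^sub>R u' k))) \<longlonglongrightarrow> norm (g (0 *\<^sub>R u))"
      by (intro tendsto_norm bounded_linear.tendsto[OF g] tendsto_intros t u')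
    \<comment> \<open>The displacement tends to 0, so by the reverse triangle inequality it cannot
      stop \<open>g\<close> of the moved points from going to infinity.\<close>
    then have "filterlim (\<lambda>k. - norm (g (t k *\<^sub>R u' k)) + norm (g (x k))) at_top sequentially"
      by (intro filterlim_tendsto_add_at_top[OF tendsto_minus lim])
    then have "filterlim (\<lambda>k. norm (g (x k + t k *\<^sub>R u' k))) at_top sequentially"
    proof (rule filterlim_at_top_mono, intro always_eventually allI)
      fix k show "- norm (g (t k *\<^sub>R u' k)) + norm (g (x k)) \<le> norm (g (x k + t k *\<^sub>R u' k))"
        using norm_diff_ineq[of "g (x k)" "g (t k *\<^sub>R u' k)"]
        by (simp add: linear_add[OF bounded_linear.linear[OF g]])
    qed
    then have "\<exists>v'. v' \<longlonglongrightarrow> v \<and> (\<forall>k. x k + t k *\<^sub>R u' k + t k *\<^sub>R v' k \<in> E)"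
      by (rule tangent_alongD[OF v u'(2) _ t])
    then obtain v' where v': "v' \<longlonglongrightarrow> v" "\<And>k. x k + t k *\<^sub>R u' k + t k *\<^sub>R v' k \<in> E"
      by blast
    show ?thesis
      using v'(2) by (intro exI[of _ "\<lambda>k. u' k + v' k"])
        (auto intro!: tendsto_add u' v' simp: scaleR_add_right add.assoc)
  qed
  then show "u + v \<in> tangent_along g E" by (auto simp: tangent_along_def)
next
  fix u and c :: real assume u: "u \<in> tangent_along g E" and "0 \<le> c"
  have "\<exists>w'. w' \<longlonglongrightarrow> c *\<^sub>R u \<and> (\<forall>k. x k + t k *\<^sub>R w' k \<in> E)"
    if x: "\<And>k. x k \<in> E" and lim: "filterlim (\<lambda>k. norm (g (x k))) at_top sequentially"
      and t: "\<And>k. t k > 0" "t \<longlonglongrightarrow> 0" for x and t :: "nat \<Rightarrow> real"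
  proof (cases "c = 0")
    case True
    then show ?thesis using x by (intro exI[of _ "\<lambda>_. 0"]) simp
  next
    case False
    with \<open>0 \<le> c\<close> have "c > 0" by simp
    \<comment> \<open>The tangent property of \<open>u\<close> is applied with step lengths
      \<open>c * t k\<close>; these must be positive, which is why \<open>c = 0\<close> was split
      off.\<close>
    moreover have "(\<lambda>k. c * t k) \<longlonglongrightarrow> 0" using tendsto_mult_right_zero[OF t(2)] .
    ultimately have "\<exists>u'. u' \<longlonglongrightarrow> u \<and> (\<forall>k. x k + (c * t k) *\<^sub>R u' k \<in> E)"
      by (intro tangent_alongD[OF u x lim] mult_pos_pos t)
    then obtain u' where "u' \<longlonglongrightarrow> u" "\<And>k. x k + (c * t k) *\<^sub>R u' k \<in> E" by blast
    then show ?thesis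
      by (intro exI[of _ "\<lambda>k. c *\<^sub>R u' k"]) (auto intro!: tendsto_intros simp: mult.commute)
  qed
  then show "c *\<^sub>R u \<in> tangent_along g E" by (auto simp: tangent_along_def)
qed

section \<open>The tangent cone of an intersection of convex sets\<close>

text \<open>If \<open>z\<close> were outside \<open>G\<close>, a separating normal \<open>p\<close>
  would satisfy \<open>inner p z \<le> inner p y\<close> on \<open>G\<close>. Points
  \<open>y\<close> close to \<open>b\<close> and \<open>-b\<close> then force
  \<open>\<bar>inner p b\<bar> < norm p / DIM('a)\<close> for each basis vector, and summing makes
  the l1 norm of \<open>p\<close> smaller than \<open>norm p\<close>. The errors
  \<open>norm (y - e)\<close> and \<open>norm z\<close> each use half of this allowance, hence the
  factor 2.\<close>

lemma convex_contains_small_cball: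
  fixes G :: "'a::euclidean_space set"
  assumes "convex G"
    and near: "\<And>e. e \<in> Basis \<union> uminus ` Basis \<Longrightarrow> \<exists>y\<in>G. norm (y - e) < 1 / (2 * DIM('a))"
    and z: "norm z \<le> 1 / (2 * DIM('a))"
  shows "z \<in> G"
proof (rule ccontr)
  assume "z \<notin> G"
  then have "0 \<notin> (\<lambda>y. y - z) ` G" by auto
  moreover have "convex ((\<lambda>y. y - z) ` G)" using assms(1) by (simp add: convex_translation_subtract_eq)
  ultimately obtain p where "p \<noteq> 0" and p: "\<And>y. y \<in> G \<Longrightarrow> 0 \<le> inner p (y - z)"
    using separating_hyperplane_set_0 by (metis imageI)
  have p_less: "\<bar>inner p b\<bar> < norm p / DIM('a)" if b: "b \<in> Basis" for b
  proof -
    have "- inner p e < norm p / DIM('a)" if e: "e \<in> Basis \<union> uminus ` Basis" for e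
    proof -
      obtain y where y: "y \<in> G" "norm (y - e) < 1 / (2 * DIM('a))" using near[OF e] by blast
      have "- inner p e \<le> inner p (y - e) - inner p z"
        using p[OF y(1)] by (simp add: inner_diff_right)
      also have "\<dots> \<le> norm p * norm (y - e) + norm p * norm z"
        using Cauchy_Schwarz_ineq2[of p "y - e"] Cauchy_Schwarz_ineq2[of p z] by linarith
      also have "\<dots> < norm p * (1 / (2 * DIM('a))) + norm p * (1 / (2 * DIM('a)))"
        using \<open>p \<noteq> 0\<close> y(2) z by (intro add_less_le_mono mult_strict_left_mono mult_left_mono) auto
      finally show ?thesis by (simp add: field_simps)
    qed
    from this[of b] this[of "-b"] b show ?thesis by (auto simp: abs_less_iff)
  qed
  have "norm p \<le> (\<Sum>b\<in>Basis. \<bar>inner p b\<bar>)" by (rule norm_le_l1)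
  also have "\<dots> < (\<Sum>b\<in>(Basis :: 'a set). norm p / DIM('a))"
    by (intro sum_strict_mono p_less) auto
  also have "\<dots> = norm p" by simp
  finally show False by simp
qed

text \<open>Halving steps of length \<open>2 * t\<close> leaves room for adding a second feasible step.\<close>

lemma convex_combine_steps:
  fixes E :: "'a::real_vector set"
  assumes "convex E" "x \<in> E" "x + (2 * t) *\<^sub>R u \<in> E" "x + (2 * t) *\<^sub>R a \<in> E" "0 \<le> \<mu>" "\<mu> \<le> 1"
  shows "x + t *\<^sub>R (u + \<mu> *\<^sub>R a) \<in> E"
proof -
  have "(1 - \<mu>) *\<^sub>R x + \<mu> *\<^sub>R (x + (2 * t) *\<^sub>R a) \<in> E" using assms by (intro convexD) auto
  then have "(1/2) *\<^sub>R (x + (2 * t) *\<^sub>R u) + (1/2) *\<^sub>R ((1 - \<mu>) *\<^sub>R x + \<mu> *\<^sub>R (x + (2 * t) *\<^sub>R a)) \<in> E"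
    using assms by (intro convexD) auto
  also have "(1/2) *\<^sub>R (x + (2 * t) *\<^sub>R u) + (1/2) *\<^sub>R ((1 - \<mu>) *\<^sub>R x + \<mu> *\<^sub>R (x + (2 * t) *\<^sub>R a))
      = (1/2) *\<^sub>R (x + x) + t *\<^sub>R (u + \<mu> *\<^sub>R a)"
    by (simp add: algebra_simps)
  also have "(1/2) *\<^sub>R (x + x) = x" by (simp add: scaleR_2[symmetric])
  finally show ?thesis .
qed

text \<open>Differences \<open>a - b\<close> of bounded feasible directions form a convex set
  containing the ball of radius \<open>\<delta>\<close>. The discrepancy \<open>v - u\<close> is
  therefore \<open>\<mu> *\<^sub>R (a - b)\<close> with
  \<open>\<mu> = norm (v - u) / \<delta>\<close>, and adding \<open>\<mu> *\<^sub>R a\<close> to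
  \<open>u\<close> and \<open>\<mu> *\<^sub>R b\<close> to \<open>v\<close> makes the two directions
  agree. The bound \<open>M\<close> keeps the correction proportional to the discrepancy.\<close>

lemma common_step:
  fixes E D :: "'a::euclidean_space set"
  defines "\<delta> \<equiv> 1 / (2 * DIM('a))"
  assumes "convex E" "convex D" "x \<in> E \<inter> D"
    and near: "\<And>e. e \<in> Basis \<union> uminus ` Basis \<Longrightarrow> \<exists>a b. x + (2 * t) *\<^sub>R a \<in> E \<and>
      x + (2 * t) *\<^sub>R b \<in> D \<and> norm a \<le> M \<and> norm b \<le> M \<and> norm (a - b - e) < \<delta>"
    and u: "x + (2 * t) *\<^sub>R u \<in> E" and v: "x + (2 * t) *\<^sub>R v \<in> D" and uv: "norm (v - u) \<le> \<delta>"
  shows "\<exists>w. norm (w - u) \<le> norm (v - u) / \<delta> * M \<and> x + t *\<^sub>R w \<in> E \<inter> D"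
proof -
  define A where "A = {a. x + (2 * t) *\<^sub>R a \<in> E} \<inter> cball 0 M"
  define B where "B = {b. x + (2 * t) *\<^sub>R b \<in> D} \<inter> cball 0 M"
  define G where "G = (\<Union>a\<in>A. \<Union>b\<in>B. {a - b})"
  have pre: "convex {a. x + s *\<^sub>R a \<in> F}" if "convex F" for F :: "'a set" and s
  proof (rule convexI)
    fix a b and p q :: real
    assume *: "a \<in> {a. x + s *\<^sub>R a \<in> F}" "b \<in> {a. x + s *\<^sub>R a \<in> F}" "0 \<le> p" "0 \<le> q" "p + q = 1"
    then have "p *\<^sub>R (x + s *\<^sub>R a) + q *\<^sub>R (x + s *\<^sub>R b) \<in> F" using that by (intro convexD) auto
    also have "p *\<^sub>R (x + s *\<^sub>R a) + q *\<^sub>R (x + s *\<^sub>R b) = (p + q) *\<^sub>R x + s *\<^sub>R (p *\<^sub>R a + q *\<^sub>R b)"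
      by (simp add: algebra_simps)
    finally show "p *\<^sub>R a + q *\<^sub>R b \<in> {a. x + s *\<^sub>R a \<in> F}" using *(5) by simp
  qed
  have "convex G"
    unfolding G_def A_def B_def by (intro convex_differences convex_Int pre assms convex_cball)
  \<comment> \<open>If \<open>v = u\<close>, then \<open>1 / \<mu> = 0\<close> and everything below still makes sense.\<close>
  define \<mu> where "\<mu> = norm (v - u) / \<delta>"
  have "\<delta> > 0" by (simp add: \<delta>_def)
  have \<mu>: "0 \<le> \<mu>" "\<mu> \<le> 1" using uv \<open>\<delta> > 0\<close> by (auto simp: \<mu>_def)
  have "norm ((1 / \<mu>) *\<^sub>R (v - u)) \<le> \<delta>" using \<open>\<delta> > 0\<close> by (simp add: \<mu>_def)
  moreover have "\<exists>y\<in>G. norm (y - e) < \<delta>" if "e \<in> Basis \<union> uminus ` Basis" for e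
    using near[OF that] by (fastforce simp: G_def A_def B_def)
  ultimately have "(1 / \<mu>) *\<^sub>R (v - u) \<in> G"
    using convex_contains_small_cball[OF \<open>convex G\<close>] unfolding \<delta>_def by blast
  then obtain a b where a: "a \<in> A" and b: "b \<in> B" and ab: "(1 / \<mu>) *\<^sub>R (v - u) = a - b"
    by (auto simp: G_def)
  have "v - u = \<mu> *\<^sub>R (a - b)"
    using \<open>\<delta> > 0\<close> unfolding ab[symmetric] by (simp add: \<mu>_def)
  then have w: "u + \<mu> *\<^sub>R a = v + \<mu> *\<^sub>R b" by (simp add: algebra_simps)
  have "x + t *\<^sub>R (u + \<mu> *\<^sub>R a) \<in> E"
    using assms a \<mu> by (intro convex_combine_steps) (auto simp: A_def)
  moreover have "x + t *\<^sub>R (u + \<mu> *\<^sub>R a) \<in> D"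
    unfolding w using assms b \<mu> by (intro convex_combine_steps) (auto simp: B_def)
  moreover have "norm (u + \<mu> *\<^sub>R a - u) \<le> \<mu> * M"
    using a \<mu> by (auto simp: A_def intro: mult_left_mono)
  ultimately show ?thesis unfolding \<mu>_def by blast
qed

text \<open>Two sequences of feasible directions with the same limit \<open>w\<close> have a
  discrepancy tending to 0, and \<open>common_step\<close> repairs it by a correction that also
  tends to 0. Its hypothesis concerns only the finitely many signed basis vectors, so it holds for
  all large \<open>k\<close> at once.\<close>

lemma tangent_along_Int:
  fixes E D :: "'a::euclidean_space set"
  assumes "convex E" "convex D"
    and gen: "\<And>z. \<exists>p\<in>tangent_along g E. \<exists>q\<in>tangent_along g D. z = p - q"
  shows "tangent_along g E \<inter> tangent_along g D \<subseteq> tangent_along g (E \<inter> D)"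
proof
  fix w assume w: "w \<in> tangent_along g E \<inter> tangent_along g D"
  define \<delta> where "\<delta> = 1 / (2 * real DIM('a))"
  have "\<delta> > 0" by (simp add: \<delta>_def)
  let ?S = "Basis \<union> uminus ` Basis :: 'a set"
  obtain a b where ab: "\<And>e. a e \<in> tangent_along g E" "\<And>e. b e \<in> tangent_along g D"
      "\<And>e. a e - b e = e"
    using gen by metis
  \<comment> \<open>The summand 1 makes the bounds on the limits \<open>a e\<close> and
    \<open>b e\<close> strict, so they eventually pass to the approximating directions.\<close>
  define M where "M = 1 + (\<Sum>e\<in>?S. norm (a e) + norm (b e))"
  have M: "norm (a e) < M" "norm (b e) < M" if "e \<in> ?S" for e
  proof -
    have "norm (a e) + norm (b e) \<le> (\<Sum>e\<in>?S. norm (a e) + norm (b e))"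
      using that by (intro member_le_sum) auto
    moreover have "0 \<le> norm (a e)" "0 \<le> norm (b e)" by simp_all
    ultimately show "norm (a e) < M" "norm (b e) < M" unfolding M_def by linarith+
  qed
  have "\<exists>w'. w' \<longlonglongrightarrow> w \<and> (\<forall>k. x k + t k *\<^sub>R w' k \<in> E \<inter> D)"
    if x: "\<And>k. x k \<in> E \<inter> D" and lim: "filterlim (\<lambda>k. norm (g (x k))) at_top sequentially"
      and t: "\<And>k. t k > 0" "t \<longlonglongrightarrow> 0" for x and t :: "nat \<Rightarrow> real"
  proof -
    \<comment> \<open>Directions are taken for doubled step lengths because
      \<open>common_step\<close> turns steps of length \<open>2 * t\<close> into one of length
      \<open>t\<close>.\<close>
    have t2: "2 * t k > 0" "(\<lambda>k. 2 * t k) \<longlonglongrightarrow> 0" for k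
      using t tendsto_mult_right_zero[OF t(2)] by auto
    have stepE: "\<exists>p'. p' \<longlonglongrightarrow> p \<and> (\<forall>k. x k + (2 * t k) *\<^sub>R p' k \<in> E)" if "p \<in> tangent_along g E" for p
      by (rule tangent_alongD[OF that _ lim t2]) (use x in auto)
    have stepD: "\<exists>p'. p' \<longlonglongrightarrow> p \<and> (\<forall>k. x k + (2 * t k) *\<^sub>R p' k \<in> D)" if "p \<in> tangent_along g D" for p
      by (rule tangent_alongD[OF that _ lim t2]) (use x in auto)
    obtain u where u: "u \<longlonglongrightarrow> w" "\<And>k. x k + (2 * t k) *\<^sub>R u k \<in> E" using stepE w by blast
    obtain v where v: "v \<longlonglongrightarrow> w" "\<And>k. x k + (2 * t k) *\<^sub>R v k \<in> D" using stepD w by blast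
    have "\<forall>e. \<exists>p'. p' \<longlonglongrightarrow> a e \<and> (\<forall>k. x k + (2 * t k) *\<^sub>R p' k \<in> E)"
      using stepE ab(1) by blast
    from choice[OF this] obtain A where A: "\<And>e. A e \<longlonglongrightarrow> a e" "\<And>e k. x k + (2 * t k) *\<^sub>R A e k \<in> E"
      by blast
    have "\<forall>e. \<exists>p'. p' \<longlonglongrightarrow> b e \<and> (\<forall>k. x k + (2 * t k) *\<^sub>R p' k \<in> D)"
      using stepD ab(2) by blast
    from choice[OF this] obtain B where B: "\<And>e. B e \<longlonglongrightarrow> b e" "\<And>e k. x k + (2 * t k) *\<^sub>R B e k \<in> D"
      by blast
    have vu: "(\<lambda>k. norm (v k - u k)) \<longlonglongrightarrow> 0"
      using tendsto_norm[OF tendsto_diff[OF v(1) u(1)]] by simp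
    define good where "good k w' \<longleftrightarrow> norm (w' - u k) \<le> norm (v k - u k) / \<delta> * M \<and>
      x k + t k *\<^sub>R w' \<in> E \<inter> D" for k w'
    have "eventually (\<lambda>k. norm (A e k) < M \<and> norm (B e k) < M \<and> norm (A e k - B e k - e) < \<delta>) sequentially"
      if e: "e \<in> ?S" for e
    proof (intro eventually_conj)
      show "eventually (\<lambda>k. norm (A e k) < M) sequentially"
        using order_tendstoD(2)[OF tendsto_norm[OF A(1)] M(1)[OF e]] .
      show "eventually (\<lambda>k. norm (B e k) < M) sequentially"
        using order_tendstoD(2)[OF tendsto_norm[OF B(1)] M(2)[OF e]] .
      have "(\<lambda>k. norm (A e k - B e k - e)) \<longlonglongrightarrow> norm (a e - b e - e)"
        by (intro tendsto_intros A B)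
      then show "eventually (\<lambda>k. norm (A e k - B e k - e) < \<delta>) sequentially"
        using \<open>\<delta> > 0\<close> ab(3) by (auto intro: order_tendstoD(2))
    qed
    then have "eventually (\<lambda>k. \<forall>e\<in>?S. norm (A e k) < M \<and> norm (B e k) < M \<and>
        norm (A e k - B e k - e) < \<delta>) sequentially"
      by (intro eventually_ball_finite) auto
    moreover have "eventually (\<lambda>k. norm (v k - u k) < \<delta>) sequentially"
      using vu \<open>\<delta> > 0\<close> by (rule order_tendstoD)
    ultimately have ev: "eventually (\<lambda>k. \<exists>w'. good k w') sequentially"
    proof eventually_elim
      case (elim k)
      have "\<exists>w'. norm (w' - u k) \<le> norm (v k - u k) / (1 / (2 * DIM('a))) * M \<and>
          x k + t k *\<^sub>R w' \<in> E \<inter> D"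
      proof (rule common_step[OF assms(1,2) x _ u(2) v(2)])
        show "\<exists>a b. x k + (2 * t k) *\<^sub>R a \<in> E \<and> x k + (2 * t k) *\<^sub>R b \<in> D \<and> norm a \<le> M \<and>
            norm b \<le> M \<and> norm (a - b - e) < 1 / (2 * DIM('a))" if "e \<in> ?S" for e
          using bspec[OF elim(1) that] A(2)[of k e] B(2)[of k e] unfolding \<delta>_def
          by - (rule exI[of _ "A e k"], rule exI[of _ "B e k"], simp add: less_imp_le)
      qed (use elim(2) in \<open>simp add: \<delta>_def\<close>)
      then show ?case by (simp add: good_def \<delta>_def)
    qed
    define w' where "w' k = (if \<exists>y. good k y then SOME y. good k y else 0)" for k
    have good: "good k (w' k)" if "\<exists>y. good k y" for k
      using that unfolding w'_def by (auto intro: someI_ex)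
    have "(\<lambda>k. norm (v k - u k) / \<delta> * M) \<longlonglongrightarrow> 0 / \<delta> * M"
      using \<open>\<delta> > 0\<close> by (intro tendsto_intros vu) simp
    then have "(\<lambda>k. norm (v k - u k) / \<delta> * M) \<longlonglongrightarrow> 0" by simp
    moreover have "eventually (\<lambda>k. norm (w' k - u k) \<le> norm (v k - u k) / \<delta> * M) sequentially"
      using ev by eventually_elim (use good good_def in blast)
    ultimately have "(\<lambda>k. w' k - u k) \<longlonglongrightarrow> 0" by (rule Lim_null_comparison[rotated])
    from tendsto_add[OF this u(1)] have "w' \<longlonglongrightarrow> w" by simp
    moreover have "x k + t k *\<^sub>R w' k \<in> E \<inter> D" for k
      using good[of k] x[of k] by (cases "\<exists>y. good k y") (auto simp: good_def w'_def)
    ultimately show ?thesis by blast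
  qed
  then show "w \<in> tangent_along g (E \<inter> D)" by (auto simp: tangent_along_def)
qed

section \<open>Differences and polars of convex cones\<close>

text \<open>A point missing from \<open>P - Q\<close> could be separated from it. A functional
  bounded below on a cone is nonnegative there, so the negative of the separating normal would be a
  nonzero vector excluded by \<open>polar\<close>.\<close>

lemma convex_cone_differences_UNIV:
  fixes P Q :: "'a::euclidean_space set"
  assumes P: "convex_cone P" and Q: "convex_cone Q"
    and polar: "\<And>a. \<lbrakk>\<And>p. p \<in> P \<Longrightarrow> inner a p \<le> 0; \<And>q. q \<in> Q \<Longrightarrow> inner a q \<ge> 0\<rbrakk> \<Longrightarrow> a = 0"
  shows "\<exists>p\<in>P. \<exists>q\<in>Q. z = p - q"
proof (rule ccontr)
  assume *: "\<not> ?thesis"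
  define G where "G = (\<Union>p\<in>P. \<Union>q\<in>Q. {p - q})"
  have "convex G" unfolding G_def using P Q by (intro convex_differences) (auto simp: convex_cone_def)
  then have "convex ((\<lambda>y. y - z) ` G)" by (simp add: convex_translation_subtract_eq)
  moreover have "0 \<notin> (\<lambda>y. y - z) ` G" using * by (force simp: G_def)
  ultimately obtain a where "a \<noteq> 0" and a: "\<And>y. y \<in> G \<Longrightarrow> 0 \<le> inner a (y - z)"
    using separating_hyperplane_set_0 by (metis imageI)
  have G0: "0 \<le> inner a y" if y: "\<And>c::real. c \<ge> 0 \<Longrightarrow> c *\<^sub>R y \<in> G" for y
  proof (rule ccontr)
    assume neg: "\<not> 0 \<le> inner a y"
    \<comment> \<open>Chosen so that \<open>c * inner a y\<close> equals
      \<open>- (\<bar>inner a z\<bar> + 1)\<close>, which lies below the lower bound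
      \<open>inner a z\<close>.\<close>
    define c where "c = (\<bar>inner a z\<bar> + 1) / - inner a y"
    have "c \<ge> 0" using neg by (simp add: c_def divide_nonneg_neg)
    from a[OF y[OF this]] have "inner a z \<le> c * inner a y" by (simp add: inner_diff_right)
    also have "c * inner a y = - (\<bar>inner a z\<bar> + 1)" using neg by (simp add: c_def)
    finally show False by linarith
  qed
  have G: "p - q \<in> G" if "p \<in> P" "q \<in> Q" for p q using that by (auto simp: G_def)
  have "0 \<in> P" "0 \<in> Q" using P Q by (simp_all add: convex_cone_contains_0)
  have "inner (- a) p \<le> 0" if "p \<in> P" for p
  proof -
    have "c *\<^sub>R p \<in> G" if "c \<ge> 0" for c :: real
      using G[OF convex_cone_scaleR[OF P that \<open>p \<in> P\<close>] \<open>0 \<in> Q\<close>] by simp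
    from G0[OF this] show ?thesis by simp
  qed
  moreover have "inner (- a) q \<ge> 0" if "q \<in> Q" for q
  proof -
    have "c *\<^sub>R (- q) \<in> G" if "c \<ge> 0" for c :: real
      using G[OF \<open>0 \<in> P\<close> convex_cone_scaleR[OF Q that \<open>q \<in> Q\<close>]] by simp
    from G0[OF this] show ?thesis by simp
  qed
  ultimately show False using polar[of "- a"] \<open>a \<noteq> 0\<close> by simp
qed

lemma polar_Int_decomposition:
  fixes P Q :: "'a::euclidean_space set"
  assumes P: "convex_cone P" and Q: "convex_cone Q"
    and gen: "\<And>z. \<exists>p\<in>P. \<exists>q\<in>Q. z = p - q"
    and u: "\<And>w. w \<in> P \<inter> Q \<Longrightarrow> inner u w \<le> 0"
  shows "\<exists>y. (\<forall>p\<in>P. inner (u - y) p \<le> 0) \<and> (\<forall>q\<in>Q. inner y q \<le> 0)"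
proof -
  \<comment> \<open>The origin is outside \<open>S\<close>, and a hyperplane separating them is not vertical because \<open>P - Q\<close>
    is the whole space; its slope is the functional sought.\<close>
  define S where "S = {(p - q, s) | p q s. p \<in> P \<and> q \<in> Q \<and> s < inner u p}"
  have "convex S"
  proof (rule convexI)
    fix X Y and \<alpha> \<beta> :: real
    assume "X \<in> S" "Y \<in> S" and \<alpha>\<beta>: "0 \<le> \<alpha>" "0 \<le> \<beta>" "\<alpha> + \<beta> = 1"
    then obtain p q s p' q' s' where X: "X = (p - q, s)" "p \<in> P" "q \<in> Q" "s < inner u p"
      and Y: "Y = (p' - q', s')" "p' \<in> P" "q' \<in> Q" "s' < inner u p'"
      unfolding S_def by blast
    have "\<alpha> *\<^sub>R p + \<beta> *\<^sub>R p' \<in> P" "\<alpha> *\<^sub>R q + \<beta> *\<^sub>R q' \<in> Q"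
      using P Q X Y \<alpha>\<beta> by (auto simp: convex_cone_iff)
    moreover have "\<alpha> * s + \<beta> * s' < inner u (\<alpha> *\<^sub>R p + \<beta> *\<^sub>R p')"
    \<comment> \<open>Strictness comes from the first summand when its weight is positive; otherwise
      \<open>\<beta> = 1\<close> and it comes from the second.\<close>
    proof (cases "\<alpha> = 0")
      case False
      then have "\<alpha> * s < \<alpha> * inner u p" "\<beta> * s' \<le> \<beta> * inner u p'"
        using \<alpha>\<beta> X Y by (auto intro: mult_left_mono)
      then show ?thesis by (simp add: inner_add_right)
    qed (use \<alpha>\<beta> Y in auto)
    moreover have "\<alpha> *\<^sub>R X + \<beta> *\<^sub>R Y =
        ((\<alpha> *\<^sub>R p + \<beta> *\<^sub>R p') - (\<alpha> *\<^sub>R q + \<beta> *\<^sub>R q'), \<alpha> * s + \<beta> * s')"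
      using X Y by (simp add: algebra_simps)
    ultimately show "\<alpha> *\<^sub>R X + \<beta> *\<^sub>R Y \<in> S" unfolding S_def by blast
  qed
  moreover have "0 \<notin> S"
  proof
    assume "0 \<in> S"
    then obtain p q where "p \<in> P" "q \<in> Q" "p - q = 0" "0 < inner u p"
      by (auto simp: S_def zero_prod_def)
    then show False using u[of p] by auto
  qed
  ultimately obtain Z where "Z \<noteq> 0" and Z: "\<And>X. X \<in> S \<Longrightarrow> 0 \<le> inner Z X"
    using separating_hyperplane_set_0 by metis
  obtain y \<alpha> where Z_eq: "Z = (y, \<alpha>)" by (cases Z)
  have sep: "0 \<le> inner y (p - q) + \<alpha> * s" if "p \<in> P" "q \<in> Q" "s < inner u p" for p q s
    using Z[of "(p - q, s)"] that by (auto simp: S_def Z_eq)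
  have "0 \<in> P" "0 \<in> Q" using P Q by (auto simp: convex_cone_iff)
  have "\<alpha> \<le> 0" using sep[OF \<open>0 \<in> P\<close> \<open>0 \<in> Q\<close>, of "-1"] by simp
  moreover have "\<alpha> \<noteq> 0"
  proof
    assume "\<alpha> = 0"
    \<comment> \<open>Representing \<open>- y\<close> itself as a difference turns the separation
      inequality into \<open>0 \<le> - inner y y\<close>.\<close>
    obtain p q where pq: "p \<in> P" "q \<in> Q" "- y = p - q" using gen[of "- y"] by blast
    have "inner y y \<le> 0" using sep[OF pq(1,2), of "inner u p - 1"] \<open>\<alpha> = 0\<close> by (simp flip: pq(3))
    then have "y = 0" using inner_ge_zero[of y] inner_eq_zero_iff[of y] by linarith
    then show False using \<open>Z \<noteq> 0\<close> \<open>\<alpha> = 0\<close> by (simp add: Z_eq zero_prod_def)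
  qed
  ultimately have "\<alpha> < 0" by simp
  \<comment> \<open>Letting \<open>s\<close> increase to \<open>inner u p\<close> gives one
    inequality that contains both claims: \<open>q = 0\<close> yields the one on \<open>P\<close>,
    \<open>p = 0\<close> the one on \<open>Q\<close>.\<close>
  have limit: "inner u p \<le> inner ((1 / - \<alpha>) *\<^sub>R y) (p - q)" if "p \<in> P" "q \<in> Q" for p q
  proof (rule dense_le)
    fix s assume "s < inner u p"
    from sep[OF that this] show "s \<le> inner ((1 / - \<alpha>) *\<^sub>R y) (p - q)"
      using \<open>\<alpha> < 0\<close> by (simp add: field_simps)
  qed
  show ?thesis
  proof (intro exI[of _ "(1 / - \<alpha>) *\<^sub>R y"] conjI ballI)
    show "inner (u - (1 / - \<alpha>) *\<^sub>R y) p \<le> 0" if "p \<in> P" for p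
      using limit[OF that \<open>0 \<in> Q\<close>] by (simp add: inner_diff_left inner_add_left)
    show "inner ((1 / - \<alpha>) *\<^sub>R y) q \<le> 0" if "q \<in> Q" for q
      using limit[OF \<open>0 \<in> P\<close> that] by simp
  qed
qed

section \<open>Epigraphs and normals to \<open>C \<times> UNIV\<close>\<close>

lemma convex_epi:
  assumes "convex_fun f"
  shows "convex (epi f)"
  unfolding convex_alt
proof (intro ballI allI impI)
  fix X Y and t :: real assume X: "X \<in> epi f" and Y: "Y \<in> epi f" and t: "0 \<le> t \<and> t \<le> 1"
  obtain x r y s where XY: "X = (x, r)" "Y = (y, s)" by (cases X, cases Y)
  show "(1 - t) *\<^sub>R X + t *\<^sub>R Y \<in> epi f"
  proof (cases "t = 0 \<or> t = 1")
    case False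
    with t have "0 < t" "t < 1" by auto
    then have "f ((1 - t) *\<^sub>R x + t *\<^sub>R y) \<le> ereal (1 - t) * f x + ereal t * f y"
      using assms by (simp add: convex_fun_def)
    also have "\<dots> \<le> ereal (1 - t) * ereal r + ereal t * ereal s"
      using X Y \<open>0 < t\<close> \<open>t < 1\<close> by (intro add_mono ereal_mult_left_mono) (auto simp: epi_def XY)
    finally show ?thesis by (simp add: epi_def XY)
  qed (use X Y in auto)
qed

lemma epi_add_indicator:
  assumes "proper_fun f"
  shows "epi (\<lambda>x. f x + indicator_fun C x) = epi f \<inter> C \<times> UNIV"
  using assms by (auto simp: epi_def indicator_fun_def proper_fun_def split: if_splits)

text \<open>The second factor is a whole line, so no nonzero slope along it can stay nonpositive:
  testing with \<open>(0, snd y)\<close> gives \<open>snd y * snd y \<le> 0\<close>.\<close>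

lemma normal_inf_if_polar_Times_UNIV:
  assumes "\<And>q. q \<in> tangent_inf C \<times> (UNIV :: real set) \<Longrightarrow> inner y q \<le> 0"
  shows "snd y = 0" "fst y \<in> normal_inf C"
proof -
  have C: "inner (fst y) w + snd y * r \<le> 0" if "w \<in> tangent_inf C" for w r
    using assms[of "(w, r)"] that by (simp add: inner_prod_def)
  have "0 \<in> tangent_inf C"
    unfolding tangent_inf_def by (auto intro!: exI[of _ "\<lambda>_. 0"])
  from C[OF this, of "snd y"] have "snd y * snd y \<le> 0" by simp
  then show "snd y = 0" by (auto simp: mult_le_0_iff)
  with C show "fst y \<in> normal_inf C" by (force simp: normal_inf_def)
qed

section \<open>The sum rule for subdifferentials at infinity\<close>

theorem theorem5p1:
  fixes f :: "real ^ 'n \<Rightarrow> ereal" and C :: "(real ^ 'n) set"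
  assumes "proper_fun f" and "lsc_fun f" and "convex_fun f"
    and "\<not> bounded (eff_dom f)"
    and "C \<noteq> {}" and "closed C" and "convex C"
    and "\<not> bounded (C \<inter> eff_dom f)"
    and "singular_subdiff_inf f \<inter> uminus ` normal_inf C = {0}"
  shows "subdiff_inf (\<lambda>x. f x + indicator_fun C x)
           \<subseteq> {u + v | u v. u \<in> subdiff_inf f \<and> v \<in> normal_inf C} \<and>
         (0 \<in> subdiff_inf (\<lambda>x. f x + indicator_fun C x) \<longrightarrow>
           (\<exists>u\<in>subdiff_inf f. \<exists>v\<in>normal_inf C. u + v = 0))"
proof -
  define P where "P = tangent_along fst (epi f)"
  define Q where "Q = tangent_along fst (C \<times> (UNIV :: real set))"
  have P: "convex_cone P" and Q: "convex_cone Q"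
    unfolding P_def Q_def by (simp_all add: convex_cone_tangent_along bounded_linear_fst)
  have normal_f: "(u, c) \<in> normal_inf_fst (epi f) \<longleftrightarrow> (\<forall>p\<in>P. inner (u, c) p \<le> 0)" for u c
    by (auto simp: normal_inf_fst_def tangent_inf_fst_eq P_def)
  have normal_C: "snd y = 0" "fst y \<in> normal_inf C" if "\<And>q. q \<in> Q \<Longrightarrow> inner y q \<le> 0" for y
    using normal_inf_if_polar_Times_UNIV[of C y] that tangent_inf_Times_UNIV[of C]
    unfolding Q_def by blast+
  have gen: "\<exists>p\<in>P. \<exists>q\<in>Q. z = p - q" for z
  proof (rule convex_cone_differences_UNIV[OF P Q])
    fix a assume aP: "\<And>p. p \<in> P \<Longrightarrow> inner a p \<le> 0" and aQ: "\<And>q. q \<in> Q \<Longrightarrow> inner a q \<ge> 0"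
    \<comment> \<open>Here \<open>- a\<close> is polar to \<open>Q\<close>, so \<open>a\<close> is
      horizontal with \<open>- fst a\<close> normal to \<open>C\<close>. Being polar to
      \<open>P\<close> as well, it has \<open>fst a\<close> in the singular subdifferential, and the
      qualification condition leaves only 0.\<close>
    have "snd (- a) = 0" "fst (- a) \<in> normal_inf C" by (rule normal_C, simp add: aQ)+
    then have "fst a \<in> uminus ` normal_inf C" and a0: "snd a = 0" by (auto intro!: image_eqI)
    moreover have "fst a \<in> singular_subdiff_inf f"
      unfolding singular_subdiff_inf_def mem_Collect_eq normal_f
      using aP a0 by (metis prod.collapse)
    ultimately have "fst a = 0" using assms(9) by blast
    with a0 show "a = 0" by (simp add: prod_eq_iff)
  qed
  have sub: "P \<inter> Q \<subseteq> tangent_inf_fst (epi (\<lambda>x. f x + indicator_fun C x))"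
    unfolding epi_add_indicator[OF assms(1)] tangent_inf_fst_eq P_def Q_def
    using assms gen
    by (intro tangent_along_Int convex_epi convex_Times) (auto simp: P_def Q_def)
  have main: "\<exists>v. z - v \<in> subdiff_inf f \<and> v \<in> normal_inf C"
    if z: "z \<in> subdiff_inf (\<lambda>x. f x + indicator_fun C x)" for z
  proof -
    have "inner (z, -1) w \<le> 0" if "w \<in> P \<inter> Q" for w
      using z sub that by (fastforce simp: subdiff_inf_def normal_inf_fst_def)
    from polar_Int_decomposition[OF P Q gen this] obtain y where
      y: "\<forall>p\<in>P. inner ((z, -1) - y) p \<le> 0" "\<forall>q\<in>Q. inner y q \<le> 0" by blast
    have "snd y = 0" "fst y \<in> normal_inf C" using normal_C y(2) by blast+
    \<comment> \<open>The \<open>C\<close> part is horizontal, so the whole component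
      \<open>-1\<close> stays with the part polar to \<open>P\<close>, which is what membership in
      \<open>subdiff_inf f\<close> requires.\<close>
    moreover from this have "(z, -1) - y = (z - fst y, -1)" by (simp add: prod_eq_iff)
    ultimately show ?thesis using y(1) by (auto simp: subdiff_inf_def normal_f)
  qed
  show ?thesis
  proof (intro conjI subsetI impI)
    fix z assume "z \<in> subdiff_inf (\<lambda>x. f x + indicator_fun C x)"
    from main[OF this] obtain v where "z - v \<in> subdiff_inf f" "v \<in> normal_inf C" by blast
    moreover have "z = (z - v) + v" by simp
    ultimately show "z \<in> {u + v | u v. u \<in> subdiff_inf f \<and> v \<in> normal_inf C}" by blast
  next
    assume "0 \<in> subdiff_inf (\<lambda>x. f x + indicator_fun C x)"
    from main[OF this] obtain v where "0 - v \<in> subdiff_inf f" "v \<in> normal_inf C" by blast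
    then show "\<exists>u\<in>subdiff_inf f. \<exists>v\<in>normal_inf C. u + v = 0" by force
  qed
qed

end
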